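(* Let $c>0$ and $S>0$ be constants, and let $T_u$, $u\ge 0$, be a positive bounded measurable function of $u$. Let $\{X(t),t\ge 0\}$ be a Lévy process such that $X(S)$ has a long-tailed distribution, i.e. there exists a function $h(u)$, $u\ge 0$, with $\lim_{u\to\infty} u/h(u)=\lim_{u\to\infty}h(u)=\infty$ such that $$\mathbb{P}\{X(S)>u+h(u)\}=\mathbb{P}\{X(S)>u\}(1+o(1)),\qquad u\to\infty.$$ Then $$\mathcal{P}_S(u,T_u)=\mathbb{P}\{X(S)>u\}(1+o(1)),\qquad u\to\infty.$$
   Context: For $u\ge 0$ and premium rate $c>0$ the risk process is $R_u(t)=u+ct-X(t)$, $t\ge 0$. The probability of Parisian ruin over $[0,S]$ is $$\mathcal{P}_S(u,T_u)=\mathbb{P}\Big\{\inf_{t\in[0,S]}\sup_{s\in[t,t+T_u]}R_u(s)<0\Big\}.$$ The notation $f(u)=g(u)(1+o(1))$ means $f(u)/g(u)\to 1$. *)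

theory Defs
  imports "HOL-Probability.Probability"
begin

definition cadlag :: "(real \<Rightarrow> real) \<Rightarrow> bool" where
  "cadlag f \<longleftrightarrow>
     (\<forall>t\<ge>0. (f \<longlongrightarrow> f t) (at_right t)) \<and>
     (\<forall>t>0. \<exists>l. (f \<longlongrightarrow> l) (at_left t))"

(* Real-valued, with time set [0, \<infinity>): the values X t for t < 0 are not constrained.
   Stochastic continuity is not listed because it follows from stationarity and right continuity. *)
locale levy_process = prob_space M
  for M :: "'a measure" and X :: "real \<Rightarrow> 'a \<Rightarrow> real" +
  assumes random_variables: "\<And>t. 0 \<le> t \<Longrightarrow> random_variable borel (X t)"
    and start: "AE \<omega> in M. X 0 \<omega> = 0"
    and indep_increments:
      "\<And>(n::nat) (t::nat \<Rightarrow> real). 0 \<le> t 0 \<Longrightarrow> (\<And>i. i < n \<Longrightarrow> t i < t (Suc i)) \<Longrightarrow>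
         indep_vars (\<lambda>_. borel) (\<lambda>i \<omega>. X (t (Suc i)) \<omega> - X (t i) \<omega>) {..<n}"
    and stationary_increments:
      "\<And>s t. 0 \<le> s \<Longrightarrow> s \<le> t \<Longrightarrow>
         distr M borel (\<lambda>\<omega>. X t \<omega> - X s \<omega>) = distr M borel (X (t - s))"
    and cadlag_paths: "AE \<omega> in M. cadlag (\<lambda>t. X t \<omega>)"

definition tail_prob :: "'a measure \<Rightarrow> ('a \<Rightarrow> real) \<Rightarrow> real \<Rightarrow> real" where
  "tail_prob M Y u = measure M {\<omega> \<in> space M. Y \<omega> > u}"

(* f = g (1 + o(1)) is written as convergence of f / g to 1; since x / 0 = 0, this forces g to be
   nonzero eventually (unlike asymp_equiv). *)
definition long_tailed :: "'a measure \<Rightarrow> ('a \<Rightarrow> real) \<Rightarrow> bool" where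
  "long_tailed M Y \<longleftrightarrow>
     (\<exists>h :: real \<Rightarrow> real.
        filterlim (\<lambda>u. u / h u) at_top at_top \<and>
        filterlim h at_top at_top \<and>
        ((\<lambda>u. tail_prob M Y (u + h u) / tail_prob M Y u) \<longlongrightarrow> 1) at_top)"

definition risk_process ::
    "real \<Rightarrow> (real \<Rightarrow> 'a \<Rightarrow> real) \<Rightarrow> real \<Rightarrow> real \<Rightarrow> 'a \<Rightarrow> real" where
  "risk_process c X u t \<omega> = u + c * t - X t \<omega>"

(* The paths are cadlag only almost surely, so the ruin event is in general measurable only with
   respect to the completion. Infimum and supremum are taken in the extended reals, so they are
   meaningful for every path. *)
definition parisian_ruin_prob ::
    "'a measure \<Rightarrow> (real \<Rightarrow> 'a \<Rightarrow> real) \<Rightarrow> real \<Rightarrow> real \<Rightarrow> real \<Rightarrow> real \<Rightarrow> real" where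
  "parisian_ruin_prob M X c S u T =
     measure (completion M)
       {\<omega> \<in> space M.
          (INF t\<in>{0..S}. SUP s\<in>{t..t + T}. ereal (risk_process c X u s \<omega>)) < 0}"

end

theory Submission
  imports Defs
begin

text \<open>
  Ruin at some time in \<open>[0, S]\<close> forces \<open>X\<close> to exceed \<open>u\<close> there. Decomposing over the first
  passage above \<open>u\<close> and using that the later increments are independent of it gives
  \<open>P(sup X > u) p(x) \<le> P(X S > u - 2 x)\<close>, where \<open>p(x) = P(sup \<bar>X\<bar> \<le> x)\<close>, both suprema being over
  \<open>[0, S]\<close>. Conversely, if \<open>X S\<close> exceeds \<open>u\<close> by a large constant and the independent increments after
  \<open>S\<close> stay above \<open>- 2 x\<close> over a time that bounds all \<open>T u\<close>, then ruin occurs at time \<open>S\<close>. A long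
  tail is insensitive to constant shifts, and cadlag paths are bounded on compact intervals, so that
  letting first \<open>u\<close> and then \<open>x\<close> tend to infinity squeezes the ratio to 1. The first
  passage argument is carried out on dyadic grids, which avoids the strong Markov property.
\<close>

subsection \<open>Sums of independent random variables\<close>

text \<open>Independence of random vectors over disjoint index sets, read as a product rule for
  events. It separates the past of a path from its later increments.\<close>

lemma (in prob_space) indep_vars_prob_conj:
  assumes "indep_vars N Y I" and "J \<inter> K = {}" "J \<subseteq> I" "K \<subseteq> I"
    and P: "Measurable.pred (PiM J N) P" and Q: "Measurable.pred (PiM K N) Q"
  shows "prob {\<omega> \<in> space M. P (\<lambda>i\<in>J. Y i \<omega>) \<and> Q (\<lambda>i\<in>K. Y i \<omega>)} =
    prob {\<omega> \<in> space M. P (\<lambda>i\<in>J. Y i \<omega>)} * prob {\<omega> \<in> space M. Q (\<lambda>i\<in>K. Y i \<omega>)}"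
proof -
  have 1: "indep_var (PiM J N) (\<lambda>\<omega>. \<lambda>i\<in>J. Y i \<omega>) (PiM K N) (\<lambda>\<omega>. \<lambda>i\<in>K. Y i \<omega>)"
    using assms by (intro indep_var_restrict)
  \<comment> \<open>The predicates are regarded as Boolean random variables, so that the two events
    are preimages of \<open>{True}\<close>.\<close>
  have 2: "indep_var (count_space UNIV) (P \<circ> (\<lambda>\<omega>. \<lambda>i\<in>J. Y i \<omega>))
      (count_space UNIV) (Q \<circ> (\<lambda>\<omega>. \<lambda>i\<in>K. Y i \<omega>))"
    by (rule indep_var_compose[OF 1 P Q])
  from indep_varD[OF 2, of "{True}" "{True}"] show ?thesis
    by (simp add: vimage_def Int_def conj_commute del: restrict_apply)
qed

lemma borel_measurable_PiM_sum [measurable]: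
  fixes J K :: "nat set"
  assumes "J \<subseteq> K"
  shows "(\<lambda>f. \<Sum>l\<in>J. f l :: real) \<in> borel_measurable (PiM K (\<lambda>_. borel))"
  using assms by (intro borel_measurable_sum measurable_component_singleton) auto

text \<open>Split by the first index \<open>j\<close> with \<open>u < W j\<close>. This event
  depends only on the terms before \<open>j\<close>, hence is independent of
  \<open>W n - W j\<close>; if in addition that remainder is at least \<open>- x\<close>, then
  \<open>W n\<close> still exceeds \<open>u - x\<close>.\<close>

lemma (in prob_space) ottaviani_inequality:
  fixes Y :: "nat \<Rightarrow> 'a \<Rightarrow> real"
  defines "W \<equiv> \<lambda>j \<omega>. \<Sum>l<j. Y l \<omega>"
  assumes indep: "indep_vars (\<lambda>_. borel) Y {..<n}"
    and p: "\<And>j. j \<le> n \<Longrightarrow> p \<le> prob {\<omega> \<in> space M. - x \<le> W n \<omega> - W j \<omega>}"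
  shows "p * prob {\<omega> \<in> space M. \<exists>j\<le>n. u < W j \<omega>} \<le> prob {\<omega> \<in> space M. u - x < W n \<omega>}"
proof -
  have [measurable]: "random_variable borel (W j)" if "j \<le> n" for j
    using indep that unfolding W_def indep_vars_def by (intro borel_measurable_sum) auto
  \<comment> \<open>\<open>A j\<close> is first passage above \<open>u\<close> at index
    \<open>j\<close>; \<open>C j\<close> says that the remaining terms lower the sum by at most
    \<open>x\<close>.\<close>
  define A where "A j = {\<omega> \<in> space M. (\<forall>i<j. W i \<omega> \<le> u) \<and> u < W j \<omega>}" for j
  define C where "C j = {\<omega> \<in> space M. - x \<le> W n \<omega> - W j \<omega>}" for j
  have mA: "A j \<in> sets M" if "j \<le> n" for j
  proof -
    \<comment> \<open>For \<open>j = 0\<close> the intersection has an empty index set, hence the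
      case distinction below.\<close>
    have "A j = (\<Inter>i\<in>{..<j}. {\<omega> \<in> space M. W i \<omega> \<le> u}) \<inter> {\<omega> \<in> space M. u < W j \<omega>} \<inter> space M"
      by (auto simp: A_def)
    then show ?thesis
      using that
      by (cases "j = 0") (auto intro!: sets.Int sets.countable_INT')
  qed
  have mC: "C j \<in> sets M" if "j \<le> n" for j
    using that unfolding C_def by measurable
  have disj: "disjoint_family_on A {..n}"
    unfolding disjoint_family_on_def
  proof (intro ballI impI)
    fix i j :: nat assume "i \<noteq> j"
    then consider "i < j" | "j < i" by linarith
    then show "A i \<inter> A j = {}"
      by cases (fastforce simp: A_def)+
  qed
  have union: "{\<omega> \<in> space M. \<exists>j\<le>n. u < W j \<omega>} = (\<Union>j\<le>n. A j)"
  proof safe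
    fix \<omega> j assume *: "\<omega> \<in> space M" "j \<le> n" "u < W j \<omega>"
    define k where "k = (LEAST k. u < W k \<omega>)"
    have "u < W k \<omega>" "k \<le> j" and less: "\<And>i. i < k \<Longrightarrow> \<not> u < W i \<omega>"
      unfolding k_def by (auto intro: LeastI[of _ j] Least_le * dest: not_less_Least simp: *)
    then show "\<omega> \<in> (\<Union>j\<le>n. A j)"
      using * by (auto simp: A_def intro!: bexI[of _ k] simp: not_less)
  qed (auto simp: A_def)
  have AC: "prob (A j \<inter> C j) = prob (A j) * prob (C j)" if "j \<le> n" for j
  proof -
    have meas: "(\<lambda>f. \<Sum>l<i. f l :: real) \<in> borel_measurable (PiM {..<j} (\<lambda>_. borel))" if "i \<le> j" for i
      using that by (intro borel_measurable_PiM_sum) auto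
    have le: "Measurable.pred (PiM {..<j} (\<lambda>_. borel)) (\<lambda>f. (\<Sum>l<i. f l :: real) \<le> u)"
      and less: "Measurable.pred (PiM {..<j} (\<lambda>_. borel)) (\<lambda>f. u < (\<Sum>l<i. f l :: real))"
      if "i \<le> j" for i
      using meas[OF that, measurable] by measurable
    \<comment> \<open>\<open>P\<close> reads only coordinates below \<open>j\<close> and
      \<open>Q\<close> only those from \<open>j\<close> on, so the product rule applies.\<close>
    define P where "P f \<longleftrightarrow> (\<forall>i\<in>{..<j}. (\<Sum>l<i. f l :: real) \<le> u) \<and> u < (\<Sum>l<j. f l)" for f
    define Q where "Q f \<longleftrightarrow> - x \<le> (\<Sum>l\<in>{j..<n}. f l :: real)" for f
    have P: "Measurable.pred (PiM {..<j} (\<lambda>_. borel)) P"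
      unfolding P_def using meas by (intro pred_intros_logic pred_intros_finite le less) auto
    have Q: "Measurable.pred (PiM {j..<n} (\<lambda>_. borel)) Q"
      unfolding Q_def by measurable
    have eq1: "(\<Sum>l<i. (\<lambda>l\<in>{..<j}. Y l \<omega>) l) = W i \<omega>" if "i \<le> j" for i \<omega>
      unfolding W_def using that by (intro sum.cong) auto
    have eq2: "(\<Sum>l\<in>{j..<n}. (\<lambda>l\<in>{j..<n}. Y l \<omega>) l) = W n \<omega> - W j \<omega>" for \<omega>
    proof -
      have "W n \<omega> = W j \<omega> + (\<Sum>l\<in>{j..<n}. Y l \<omega>)"
        unfolding W_def using sum.atLeastLessThan_concat[of 0 j n "\<lambda>l. Y l \<omega>"] \<open>j \<le> n\<close>
        by (simp add: lessThan_atLeast0)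
      then show ?thesis by simp
    qed
    have "P (\<lambda>l\<in>{..<j}. Y l \<omega>) \<longleftrightarrow> (\<forall>i<j. W i \<omega> \<le> u) \<and> u < W j \<omega>" for \<omega>
      unfolding P_def by (simp add: eq1 Ball_def del: restrict_apply)
    then have A': "A j = {\<omega> \<in> space M. P (\<lambda>l\<in>{..<j}. Y l \<omega>)}"
      by (simp add: A_def)
    have C': "C j = {\<omega> \<in> space M. Q (\<lambda>l\<in>{j..<n}. Y l \<omega>)}"
      unfolding C_def Q_def by (simp only: eq2)
    have "A j \<inter> C j = {\<omega> \<in> space M. P (\<lambda>l\<in>{..<j}. Y l \<omega>) \<and> Q (\<lambda>l\<in>{j..<n}. Y l \<omega>)}"
      unfolding A' C' by blast
    moreover have "prob \<dots> = prob (A j) * prob (C j)"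
      unfolding A' C' using \<open>j \<le> n\<close> by (intro indep_vars_prob_conj[OF indep _ _ _ P Q]) auto
    ultimately show ?thesis by simp
  qed
  \<comment> \<open>First-passage events are disjoint, so the factor \<open>p\<close> can be
    absorbed term by term as \<open>prob (C j)\<close> and the sum reassembled.\<close>
  have "p * prob {\<omega> \<in> space M. \<exists>j\<le>n. u < W j \<omega>} = (\<Sum>j\<le>n. p * prob (A j))"
    unfolding union using disj mA
    by (subst finite_measure_finite_Union) (auto simp: sum_distrib_left)
  also have "\<dots> \<le> (\<Sum>j\<le>n. prob (A j \<inter> C j))"
  proof (rule sum_mono)
    fix j assume "j \<in> {..n}"
    then have "p \<le> prob (C j)" using p by (simp add: C_def)
    then have "p * prob (A j) \<le> prob (C j) * prob (A j)" by (rule mult_right_mono) simp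
    then show "p * prob (A j) \<le> prob (A j \<inter> C j)" using \<open>j \<in> {..n}\<close> by (simp add: AC mult.commute)
  qed
  also have "\<dots> = prob (\<Union>j\<le>n. A j \<inter> C j)"
    using disj mA mC
    by (intro finite_measure_finite_Union[symmetric]) (auto simp: disjoint_family_on_def)
  also have "\<dots> \<le> prob {\<omega> \<in> space M. u - x < W n \<omega>}"
    by (intro finite_measure_mono) (auto simp: A_def C_def)
  finally show ?thesis .
qed

subsection \<open>Dyadic points and right-continuous paths\<close>

text \<open>Halving the mesh makes the grids increase with \<open>n\<close>, as the monotone limits
  over \<open>n\<close> require, and keeps both endpoints in every grid.\<close>

definition dyadic_grid :: "real \<Rightarrow> real \<Rightarrow> nat \<Rightarrow> real set" where
  "dyadic_grid a b n = (\<lambda>k. a + (b - a) * (real k / 2 ^ n)) ` {..2 ^ n}"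

definition dyadic_points :: "real \<Rightarrow> real \<Rightarrow> real set" where
  "dyadic_points a b = (\<Union>n. dyadic_grid a b n)"

lemma finite_dyadic_grid [simp]: "finite (dyadic_grid a b n)"
  by (simp add: dyadic_grid_def)

lemma countable_dyadic_points [simp]: "countable (dyadic_points a b)"
  by (simp add: dyadic_points_def countable_finite)

lemma dyadic_grid_subset: "a \<le> b \<Longrightarrow> dyadic_grid a b n \<subseteq> {a..b}"
  unfolding dyadic_grid_def
proof safe
  fix k :: nat assume "a \<le> b" "k \<le> 2 ^ n"
  then have "real k / 2 ^ n \<le> 1" by (simp add: divide_le_eq)
  with \<open>a \<le> b\<close> have "(b - a) * (real k / 2 ^ n) \<le> (b - a) * 1"
    by (intro mult_left_mono) auto
  with \<open>a \<le> b\<close> show "a + (b - a) * (real k / 2 ^ n) \<in> {a..b}" by auto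
qed

lemma dyadic_points_subset: "a \<le> b \<Longrightarrow> dyadic_points a b \<subseteq> {a..b}"
  using dyadic_grid_subset by (auto simp: dyadic_points_def)

lemma dyadic_grid_Suc: "dyadic_grid a b n \<subseteq> dyadic_grid a b (Suc n)"
  unfolding dyadic_grid_def
proof safe
  fix k :: nat assume "k \<le> 2 ^ n"
  then show "a + (b - a) * (real k / 2 ^ n) \<in> (\<lambda>k. a + (b - a) * (real k / 2 ^ Suc n)) ` {..2 ^ Suc n}"
    by (intro image_eqI[of _ _ "2 * k"]) auto
qed

lemma dyadic_grid_mono: "m \<le> n \<Longrightarrow> dyadic_grid a b m \<subseteq> dyadic_grid a b n"
  using lift_Suc_mono_le[of "dyadic_grid a b" m n] dyadic_grid_Suc by blast

lemma left_in_dyadic_points: "a \<in> dyadic_points a b"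
  unfolding dyadic_points_def dyadic_grid_def by (intro UN_I[of 0] image_eqI[of _ _ 0]) auto

lemma right_in_dyadic_points: "b \<in> dyadic_points a b"
  unfolding dyadic_points_def dyadic_grid_def by (intro UN_I[of 0] image_eqI[of _ _ 1]) auto

text \<open>The point found is strictly to the right of \<open>t\<close>, because right limits say
  nothing about \<open>t\<close> itself.\<close>

lemma dyadic_points_right_dense:
  assumes "a \<le> t" "t < b" "0 < e"
  shows "\<exists>d\<in>dyadic_points a b. t < d \<and> d < t + e"
proof -
  define e' where "e' = e / (b - a)"
  have "e' > 0" using assms by (simp add: e'_def)
  then obtain n where n: "(1 / 2) ^ n < e'"
    using real_arch_pow_inv[of e' "1 / 2"] by auto
  define r where "r = (t - a) / (b - a)"
  have r: "0 \<le> r" "r < 1" using assms by (auto simp: r_def)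
  \<comment> \<open>With \<open>k\<close> the floor, the grid point of index \<open>k + 1\<close> is
    strictly beyond \<open>t\<close>, by at most one mesh width; \<open>r < 1\<close> keeps that
    index within the grid.\<close>
  define k where "k = nat (\<lfloor>r * 2 ^ n\<rfloor>)"
  have k: "real k \<le> r * 2 ^ n" "r * 2 ^ n < real k + 1"
    using r by (auto simp: k_def)
  have "r * 2 ^ n < 1 * 2 ^ n"
    using r by (intro mult_strict_right_mono) auto
  with k(1) have "real k < 2 ^ n" by linarith
  then have k': "Suc k \<le> 2 ^ n"
    by (simp add: Suc_le_eq)
  define d where "d = a + (b - a) * (real (Suc k) / 2 ^ n)"
  have "d \<in> dyadic_points a b"
    using k' unfolding d_def dyadic_points_def dyadic_grid_def
    by (intro UN_I[of n] image_eqI[of _ _ "Suc k"]) auto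
  moreover have "t = a + (b - a) * r" using assms by (simp add: r_def)
  moreover have "r < real (Suc k) / 2 ^ n"
    using k by (simp add: field_simps)
  moreover have "real (Suc k) / 2 ^ n < r + e'"
  proof -
    have "real (Suc k) / 2 ^ n = real k / 2 ^ n + (1 / 2) ^ n"
      by (simp add: add_divide_distrib power_divide)
    moreover have "real k / 2 ^ n \<le> r" using k by (simp add: field_simps)
    ultimately show ?thesis using n by linarith
  qed
  moreover have "(b - a) * e' = e" using assms by (simp add: e'_def)
  ultimately have "t < d" "d < t + e"
    using assms mult_strict_left_mono[of r "real (Suc k) / 2 ^ n" "b - a"]
      mult_strict_left_mono[of "real (Suc k) / 2 ^ n" "r + e'" "b - a"]
    unfolding d_def distrib_left by linarith+
  with \<open>d \<in> dyadic_points a b\<close> show ?thesis by blast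
qed

text \<open>At \<open>t = b\<close> nothing to the right is available; there \<open>b\<close> itself
  is the dyadic point, which is why \<open>Q t\<close> is assumed.\<close>

lemma dyadic_points_eventually_right:
  assumes "a \<le> t" "t \<le> b" "Q t" "eventually Q (at_right t)"
  shows "\<exists>d\<in>dyadic_points a b. t \<le> d \<and> Q d"
proof (cases "t = b")
  case True
  then show ?thesis using right_in_dyadic_points assms by auto
next
  case False
  obtain e where "e > t" and e: "\<And>s. t < s \<Longrightarrow> s < e \<Longrightarrow> Q s"
    using assms(4) unfolding eventually_at_right_field by blast
  obtain d where "d \<in> dyadic_points a b" "t < d" "d < t + (e - t)"
    using dyadic_points_right_dense[of a t b "e - t"] assms False \<open>e > t\<close> by auto
  then show ?thesis using e[of d] by (intro bexI[of _ d]) auto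
qed

section \<open>Right-continuous and cadlag paths\<close>

lemma cadlag_right: "cadlag f \<Longrightarrow> 0 \<le> t \<Longrightarrow> (f \<longlongrightarrow> f t) (at_right t)"
  by (simp add: cadlag_def)

text \<open>A strict violation \<open>f t < m\<close> would persist immediately to the right of
  \<open>t\<close> and so reach a dyadic point.\<close>

lemma right_continuous_ge_dyadic_points:
  fixes f :: "real \<Rightarrow> real"
  assumes f: "\<And>t. a \<le> t \<Longrightarrow> t \<le> b \<Longrightarrow> (f \<longlongrightarrow> f t) (at_right t)"
    and ge: "\<And>t. t \<in> dyadic_points a b \<Longrightarrow> m \<le> f t" and t: "a \<le> t" "t \<le> b"
  shows "m \<le> f t"
proof (rule ccontr)
  assume "\<not> m \<le> f t"
  then obtain d where "d \<in> dyadic_points a b" "f d < m"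
    using dyadic_points_eventually_right[of a t b "\<lambda>s. f s < m"] f[OF t] t
    by (auto simp: not_le dest: order_tendstoD(2))
  then show False using ge by force
qed

text \<open>One-sided limits bound \<open>f\<close> on each side of every point, the value at the
  point adds one more bound, and compactness in the form of Bolzano's bisection principle combines
  the local bounds.\<close>

lemma cadlag_bounded:
  assumes "cadlag f" "0 \<le> a" "a \<le> b"
  shows "bounded (f ` {a..b})"
proof -
  have near: "\<exists>e>0. \<exists>B. \<forall>s. s \<in> U \<longrightarrow> \<bar>s - x\<bar> < e \<longrightarrow> \<bar>f s\<bar> \<le> B"
    if lim: "(f \<longlongrightarrow> l) (at x within U)" and "x \<notin> U" for x l U
  proof -
    have "eventually (\<lambda>s. dist (f s) l < 1) (at x within U)"
      using lim by (rule tendstoD) simp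
    then obtain e where "e > 0" and e: "\<And>s. s \<in> U \<Longrightarrow> s \<noteq> x \<Longrightarrow> dist s x < e \<Longrightarrow> dist (f s) l < 1"
      unfolding eventually_at by auto
    then show ?thesis
      using \<open>x \<notin> U\<close>
      by (intro exI[of _ e] conjI exI[of _ "\<bar>l\<bar> + 1"]) (force simp: dist_real_def)+
  qed
  \<comment> \<open>The premise is part of the induction predicate, since short intervals around a
    point may reach below 0, where nothing is known of \<open>f\<close>.\<close>
  have "0 \<le> a \<longrightarrow> (\<exists>B. \<forall>s\<in>{a..b}. \<bar>f s\<bar> \<le> B)"
    using \<open>a \<le> b\<close>
  proof (induction rule: Bolzano)
    case (trans a b c)
    show ?case
    proof
      assume "0 \<le> a"
      with trans obtain B B' where "\<forall>s\<in>{a..b}. \<bar>f s\<bar> \<le> B" "\<forall>s\<in>{b..c}. \<bar>f s\<bar> \<le> B'"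
        by fastforce
      then have "\<bar>f s\<bar> \<le> max B B'" if "s \<in> {a..c}" for s
        using that by (cases "s \<le> b") (auto simp: le_max_iff_disj)
      then show "\<exists>B. \<forall>s\<in>{a..c}. \<bar>f s\<bar> \<le> B"
        by blast
    qed
  next
    case (local x)
    then have "0 \<le> x" using assms by simp
    obtain e1 B1 where right: "e1 > 0" "\<And>s. s > x \<Longrightarrow> \<bar>s - x\<bar> < e1 \<Longrightarrow> \<bar>f s\<bar> \<le> B1"
      using near[OF cadlag_right[OF assms(1) \<open>0 \<le> x\<close>]] by auto
    obtain e2 B2 where left: "e2 > 0" "\<And>s. s < x \<Longrightarrow> 0 \<le> s \<Longrightarrow> \<bar>s - x\<bar> < e2 \<Longrightarrow> \<bar>f s\<bar> \<le> B2"
    \<comment> \<open>There is no left limit at 0, but also no \<open>s\<close> with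
      \<open>0 \<le> s < 0\<close>, so any constants serve.\<close>
    proof (cases "x = 0")
      case True
      then show ?thesis using that[of 1 0] by auto
    next
      case False
      then obtain l where "(f \<longlongrightarrow> l) (at_left x)"
        using assms(1) \<open>0 \<le> x\<close> unfolding cadlag_def by force
      from near[OF this] show ?thesis using that by auto
    qed
    show ?case
    proof (rule exI[of _ "min e1 e2"], intro conjI allI impI)
      fix l r assume lr: "l \<le> x \<and> x \<le> r \<and> r - l < min e1 e2" and "0 \<le> l"
      have "\<bar>f s\<bar> \<le> max \<bar>f x\<bar> (max B1 B2)" if "s \<in> {l..r}" for s
      proof -
        consider "s = x" | "s < x" | "x < s" by linarith
        then show ?thesis
        proof cases
          case 2
          then show ?thesis using left(2)[of s] lr that \<open>0 \<le> l\<close> by (auto simp: le_max_iff_disj)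
        next
          case 3
          then show ?thesis using right(2)[of s] lr that by (auto simp: le_max_iff_disj)
        qed simp
      qed
      then show "\<exists>B. \<forall>s\<in>{l..r}. \<bar>f s\<bar> \<le> B" by blast
    qed (use right left in auto)
  qed
  then show ?thesis
    using assms by (auto simp: bounded_iff)
qed

text \<open>This writes ruin through countably many times. The margin
  \<open>inverse (real (Suc k))\<close> is essential: a supremum of negative values may be 0, while
  a uniform non-strict bound passes from dyadic points to the whole window.\<close>

lemma parisian_ruin_dyadic_points:
  fixes g :: "real \<Rightarrow> real"
  assumes g: "\<And>t. 0 \<le> t \<Longrightarrow> (g \<longlongrightarrow> g t) (at_right t)" and "0 \<le> S" "0 \<le> T"
  shows "(INF t\<in>{0..S}. SUP s\<in>{t..t + T}. ereal (g s)) < 0 \<longleftrightarrow>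
    (\<exists>t\<in>dyadic_points 0 S. \<exists>k::nat. \<forall>s\<in>dyadic_points t (t + T). g s \<le> - inverse (real (Suc k)))"
proof
  assume "(INF t\<in>{0..S}. SUP s\<in>{t..t + T}. ereal (g s)) < 0"
  then obtain t where t: "0 \<le> t" "t \<le> S" "(SUP s\<in>{t..t + T}. ereal (g s)) < 0"
    by (auto simp: INF_less_iff)
  obtain r where r: "(SUP s\<in>{t..t + T}. ereal (g s)) < ereal r" "ereal r < 0"
    using ereal_dense2[OF t(3)] by auto
  have less: "g s < r" if "s \<in> {t..t + T}" for s
    using le_less_trans[OF SUP_upper[OF that] r(1)] by simp
  \<comment> \<open>Moving the window slightly to the right, to a dyadic starting time, adds only
    times just after \<open>t + T\<close>; right continuity there keeps \<open>g\<close> below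
    \<open>r\<close>.\<close>
  have "eventually (\<lambda>s. g s < r) (at_right (t + T))"
    using g[of "t + T"] less[of "t + T"] t \<open>0 \<le> T\<close> by (intro order_tendstoD(2)) auto
  then obtain e where e: "e > t + T" "\<And>s. t + T < s \<Longrightarrow> s < e \<Longrightarrow> g s < r"
    unfolding eventually_at_right_field by blast
  have "eventually (\<lambda>t'. \<forall>s\<in>{t'..t' + T}. g s < r) (at_right t)"
    unfolding eventually_at_right_field
  proof (intro exI[of _ "e - T"] conjI allI impI ballI)
    fix t' s assume "t < t'" "t' < e - T" "s \<in> {t'..t' + T}"
    then show "g s < r" using less[of s] e(2)[of s] by (cases "s \<le> t + T") auto
  qed (use e in auto)
  then obtain d where d: "d \<in> dyadic_points 0 S" "\<forall>s\<in>{d..d + T}. g s < r"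
    using dyadic_points_eventually_right[of 0 t S "\<lambda>t'. \<forall>s\<in>{t'..t' + T}. g s < r"] t less by blast
  obtain k where k: "inverse (real (Suc k)) < - r"
    using reals_Archimedean[of "- r"] r(2) by auto
  have "\<forall>s\<in>dyadic_points d (d + T). g s \<le> - inverse (real (Suc k))"
    using d(2) dyadic_points_subset[of d "d + T"] \<open>0 \<le> T\<close> k by force
  with d(1) show "\<exists>t\<in>dyadic_points 0 S. \<exists>k::nat. \<forall>s\<in>dyadic_points t (t + T). g s \<le> - inverse (real (Suc k))"
    by blast
next
  assume "\<exists>t\<in>dyadic_points 0 S. \<exists>k::nat. \<forall>s\<in>dyadic_points t (t + T). g s \<le> - inverse (real (Suc k))"
  then obtain t k where t: "t \<in> dyadic_points 0 S"
    and k: "\<And>s. s \<in> dyadic_points t (t + T) \<Longrightarrow> g s \<le> - inverse (real (Suc k))" by blast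
  have t': "t \<in> {0..S}" using t dyadic_points_subset \<open>0 \<le> S\<close> by blast
  \<comment> \<open>The sign is flipped because the transfer from dyadic points is stated for lower
    bounds.\<close>
  have "inverse (real (Suc k)) \<le> - g s" if "s \<in> {t..t + T}" for s
  proof (rule right_continuous_ge_dyadic_points[where a = t and b = "t + T" and f = "\<lambda>s. - g s"])
    show "((\<lambda>s. - g s) \<longlongrightarrow> - g r) (at_right r)" if "t \<le> r" for r
      using g[of r] that t' by (intro tendsto_minus) auto
    show "inverse (real (Suc k)) \<le> - g r" if "r \<in> dyadic_points t (t + T)" for r
      using k[OF that] by linarith
  qed (use that in auto)
  then have "(SUP s\<in>{t..t + T}. ereal (g s)) \<le> ereal (- inverse (real (Suc k)))"
    by (intro SUP_least) (force simp del: of_nat_Suc)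
  also have "\<dots> < 0" by simp
  finally show "(INF t\<in>{0..S}. SUP s\<in>{t..t + T}. ereal (g s)) < 0"
    using t' by (auto simp: INF_less_iff)
qed

subsection \<open>Long-tailed distributions\<close>

lemma (in prob_space) tail_prob_antimono:
  assumes "random_variable borel Y" "u \<le> v"
  shows "tail_prob M Y v \<le> tail_prob M Y u"
  using assms unfolding tail_prob_def by (intro finite_measure_mono) auto

text \<open>Eventually \<open>h u\<close> exceeds a fixed \<open>y\<close>, so for
  \<open>0 \<le> y\<close> monotonicity squeezes the ratio between the one for \<open>h\<close> and
  1.\<close>

lemma (in prob_space) long_tailed_shift:
  assumes Y: "random_variable borel Y" and "long_tailed M Y"
  shows "((\<lambda>u. tail_prob M Y (u + y) / tail_prob M Y u) \<longlongrightarrow> 1) at_top"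
proof -
  obtain h where h: "filterlim h at_top at_top"
    and lim: "((\<lambda>u. tail_prob M Y (u + h u) / tail_prob M Y u) \<longlongrightarrow> 1) at_top"
    using assms unfolding long_tailed_def by auto
  have nonneg: "((\<lambda>u. tail_prob M Y (u + y) / tail_prob M Y u) \<longlongrightarrow> 1) at_top" if "0 \<le> y" for y
  proof (rule tendsto_sandwich[OF _ _ lim tendsto_const])
    have "eventually (\<lambda>u. y \<le> h u) at_top"
      using h by (simp add: filterlim_at_top)
    then show "eventually (\<lambda>u. tail_prob M Y (u + h u) / tail_prob M Y u
        \<le> tail_prob M Y (u + y) / tail_prob M Y u) at_top"
      by eventually_elim
        (intro divide_right_mono tail_prob_antimono Y, auto simp: tail_prob_def)
    \<comment> \<open>This includes a vanishing denominator, where the quotient is 0.\<close>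
    have "tail_prob M Y (u + y) / tail_prob M Y u \<le> 1" for u
      using tail_prob_antimono[OF Y, of u "u + y"] \<open>0 \<le> y\<close>
      by (auto simp: divide_le_eq_1 tail_prob_def zero_less_measure_iff)
    then show "eventually (\<lambda>u. tail_prob M Y (u + y) / tail_prob M Y u \<le> 1) at_top"
      by simp
  qed
  show ?thesis
  proof (cases "0 \<le> y")
    case False
    \<comment> \<open>For negative \<open>y\<close>, the shift by \<open>- y\<close> is applied at
      the point \<open>u + y\<close>, and the resulting ratio is inverted.\<close>
    have "filterlim (\<lambda>u. y + u) at_top at_top"
      by (intro filterlim_tendsto_add_at_top[OF tendsto_const] filterlim_ident)
    from filterlim_compose[OF nonneg this, of "- y"]
    have "((\<lambda>u. tail_prob M Y u / tail_prob M Y (u + y)) \<longlongrightarrow> 1) at_top"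
      using False by (simp add: add.commute)
    from tendsto_inverse[OF this] show ?thesis by simp
  qed (rule nonneg)
qed

text \<open>Division by 0 gives 0, so a ratio tending to 1 excludes zero denominators.\<close>

lemma (in prob_space) long_tailed_tail_pos:
  assumes "long_tailed M Y"
  shows "eventually (\<lambda>u. 0 < tail_prob M Y u) at_top"
proof -
  obtain h where "((\<lambda>u. tail_prob M Y (u + h u) / tail_prob M Y u) \<longlongrightarrow> 1) at_top"
    using assms unfolding long_tailed_def by auto
  then have "eventually (\<lambda>u. 0 < tail_prob M Y (u + h u) / tail_prob M Y u) at_top"
    by (rule order_tendstoD) simp
  then show ?thesis
    by eventually_elim (auto simp: tail_prob_def zero_less_measure_iff)
qed

subsection \<open>Bounds for Levy processes\<close>

context levy_process
begin

lemma dyadic_points_random_variable: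
  "0 \<le> a \<Longrightarrow> a \<le> b \<Longrightarrow> t \<in> dyadic_points a b \<Longrightarrow> random_variable borel (X t)"
  using dyadic_points_subset[of a b] by (intro random_variables) auto

text \<open>Almost every path is bounded on the compact interval, so these increasing events exhaust
  the space up to a null set. Restricting to dyadic times makes them measurable.\<close>

lemma prob_dyadic_bounded_tendsto:
  assumes "0 \<le> a" "a \<le> b"
  shows "(\<lambda>k. prob {\<omega> \<in> space M. \<forall>t\<in>dyadic_points a b. \<bar>X t \<omega>\<bar> \<le> real k}) \<longlonglongrightarrow> 1"
proof -
  define A where "A k = {\<omega> \<in> space M. \<forall>t\<in>dyadic_points a b. \<bar>X t \<omega>\<bar> \<le> real k}" for k
  note [measurable] = dyadic_points_random_variable[OF assms]
  have A: "A k \<in> sets M" for k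
    unfolding A_def by measurable
  have "incseq A"
    unfolding incseq_def A_def by force
  then have "(\<lambda>k. prob (A k)) \<longlonglongrightarrow> prob (\<Union>k. A k)"
    using A by (intro finite_Lim_measure_incseq) auto
  also have "prob (\<Union>k. A k) = 1"
  proof (subst prob_eq_1)
    show "AE \<omega> in M. \<omega> \<in> (\<Union>k. A k)"
      using cadlag_paths AE_space
    proof eventually_elim
      case (elim \<omega>)
      from cadlag_bounded[OF elim(1) assms] obtain B where B: "\<And>t. t \<in> {a..b} \<Longrightarrow> \<bar>X t \<omega>\<bar> \<le> B"
        unfolding bounded_iff by (metis imageI real_norm_def)
      obtain k where "B \<le> real k" using real_arch_simple by blast
      then have "\<omega> \<in> A k"
        using B dyadic_points_subset[OF assms(2)] elim(2) by (force simp: A_def)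
      then show ?case by blast
    qed
  qed (use A in auto)
  finally show ?thesis by (simp add: A_def)
qed

section \<open>Upper bound for exceeding a level before time \<open>S\<close>\<close>

text \<open>Ottaviani's inequality for the increments along the grid. If the path stays within
  \<open>x\<close> of 0, every remaining increment \<open>X S - X (t j)\<close> is at least
  \<open>- 2 * x\<close>, so one event serves all \<open>j\<close>.\<close>

lemma prob_exceeds_grid_le:
  assumes "0 < S"
  shows "prob {\<omega> \<in> space M. \<forall>t\<in>dyadic_points 0 S. \<bar>X t \<omega>\<bar> \<le> x} *
      prob {\<omega> \<in> space M. \<exists>t\<in>dyadic_grid 0 S n. u < X t \<omega>}
    \<le> prob {\<omega> \<in> space M. u - 2 * x < X S \<omega>}" (is "?p * _ \<le> _")
proof -
  define t where "t k = 0 + (S - 0) * (real k / 2 ^ n)" for k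
  define Y where "Y k \<omega> = X (t (Suc k)) \<omega> - X (t k) \<omega>" for k \<omega>
  have t0: "t 0 = 0" and tn: "t (2 ^ n) = S" and tpos: "0 \<le> t k" for k
    using assms by (auto simp: t_def)
  have grid: "dyadic_grid 0 S n = t ` {..2 ^ n}"
    by (simp add: dyadic_grid_def t_def)
  have td: "t k \<in> dyadic_points 0 S" if "k \<le> 2 ^ n" for k
    using that grid by (auto simp: dyadic_points_def)
  note [measurable] = random_variables[OF tpos] random_variables[OF less_imp_le[OF assms(1)]] random_variables[OF order_refl]
  have sum: "(\<Sum>l<j. Y l \<omega>) = X (t j) \<omega> - X 0 \<omega>" for j \<omega>
    unfolding Y_def by (subst sum_lessThan_telescope) (simp add: t0)
  have ott: "?p * prob {\<omega> \<in> space M. \<exists>j\<le>2 ^ n. u < (\<Sum>l<j. Y l \<omega>)}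
      \<le> prob {\<omega> \<in> space M. u - 2 * x < (\<Sum>l<2 ^ n. Y l \<omega>)}"
  proof (rule ottaviani_inequality)
    show "indep_vars (\<lambda>_. borel) Y {..<2 ^ n}"
      unfolding Y_def using assms
      by (intro indep_increments) (auto simp: t_def divide_strict_right_mono)
    show "?p \<le> prob {\<omega> \<in> space M. - (2 * x) \<le> (\<Sum>l<2 ^ n. Y l \<omega>) - (\<Sum>l<j. Y l \<omega>)}"
      if "j \<le> 2 ^ n" for j
    proof (rule finite_measure_mono)
      show "{\<omega> \<in> space M. \<forall>t\<in>dyadic_points 0 S. \<bar>X t \<omega>\<bar> \<le> x}
        \<subseteq> {\<omega> \<in> space M. - (2 * x) \<le> (\<Sum>l<2 ^ n. Y l \<omega>) - (\<Sum>l<j. Y l \<omega>)}"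
        unfolding sum tn
      proof safe
        fix \<omega> assume *: "\<forall>t\<in>dyadic_points 0 S. \<bar>X t \<omega>\<bar> \<le> x"
        have "\<bar>X S \<omega>\<bar> \<le> x" "\<bar>X (t j) \<omega>\<bar> \<le> x"
          using * td[OF that] right_in_dyadic_points by blast+
        then show "- (2 * x) \<le> X S \<omega> - X 0 \<omega> - (X (t j) \<omega> - X 0 \<omega>)" by linarith
      qed
      show "{\<omega> \<in> space M. - (2 * x) \<le> (\<Sum>l<2 ^ n. Y l \<omega>) - (\<Sum>l<j. Y l \<omega>)} \<in> events"
        unfolding sum using assms by measurable
    qed
  qed
  \<comment> \<open>The partial sums telescope to \<open>X (t j) - X 0\<close>, and
    \<open>X 0\<close> vanishes only almost surely, so the events agree up to null sets.\<close>
  have "prob {\<omega> \<in> space M. \<exists>j\<le>2 ^ n. u < (\<Sum>l<j. Y l \<omega>)} =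
      prob {\<omega> \<in> space M. \<exists>t\<in>dyadic_grid 0 S n. u < X t \<omega>}"
    using start unfolding sum grid
    by (intro prob_eq_AE) (auto elim!: eventually_mono)
  moreover have "prob {\<omega> \<in> space M. u - 2 * x < (\<Sum>l<2 ^ n. Y l \<omega>)} =
      prob {\<omega> \<in> space M. u - 2 * x < X S \<omega>}"
    using start assms unfolding sum tn
    by (intro prob_eq_AE) (auto elim!: eventually_mono)
  ultimately show ?thesis using ott by simp
qed

text \<open>The grid events increase to the dyadic one and the bound does not depend on
  \<open>n\<close>, so continuity from below suffices.\<close>

lemma prob_exceeds_le:
  assumes "0 < S"
  shows "prob {\<omega> \<in> space M. \<forall>t\<in>dyadic_points 0 S. \<bar>X t \<omega>\<bar> \<le> x} *
      prob {\<omega> \<in> space M. \<exists>t\<in>dyadic_points 0 S. u < X t \<omega>}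
    \<le> prob {\<omega> \<in> space M. u - 2 * x < X S \<omega>}"
proof -
  define B where "B n = {\<omega> \<in> space M. \<exists>t\<in>dyadic_grid 0 S n. u < X t \<omega>}" for n
  have [measurable]: "random_variable borel (X t)" if "t \<in> dyadic_grid 0 S n" for t n
    using that assms dyadic_grid_subset[of 0 S n] by (intro random_variables) auto
  have "B n \<in> sets M" for n
    unfolding B_def by measurable
  moreover have "incseq B"
    unfolding incseq_def B_def using dyadic_grid_mono by blast
  ultimately have "(\<lambda>n. prob (B n)) \<longlonglongrightarrow> prob (\<Union>n. B n)"
    by (intro finite_Lim_measure_incseq) auto
  also have "(\<Union>n. B n) = {\<omega> \<in> space M. \<exists>t\<in>dyadic_points 0 S. u < X t \<omega>}"
    by (auto simp: B_def dyadic_points_def)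
  finally show ?thesis
    using prob_exceeds_grid_le[OF assms] unfolding B_def
    by (intro LIMSEQ_le_const2[OF tendsto_mult_left]) auto
qed

section \<open>Lower bound for staying high after time \<open>S\<close>\<close>

text \<open>\<open>X S\<close> is almost surely the increment over \<open>[0, S]\<close>, hence
  independent of the increments after \<open>S\<close>; a path within \<open>x\<close> of 0 on
  \<open>[S, S + K]\<close> never falls more than \<open>2 * x\<close> below its value at
  \<open>S\<close>.\<close>

lemma prob_stays_grid_ge:
  assumes "0 < S" "0 < K"
  shows "prob {\<omega> \<in> space M. a < X S \<omega>} *
      prob {\<omega> \<in> space M. \<forall>t\<in>dyadic_points S (S + K). \<bar>X t \<omega>\<bar> \<le> x}
    \<le> prob {\<omega> \<in> space M. a < X S \<omega> \<and> (\<forall>t\<in>dyadic_grid S (S + K) n. - (2 * x) \<le> X t \<omega> - X S \<omega>)}"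
proof -
  \<comment> \<open>The time 0 is put in front of the grid of \<open>[S, S + K]\<close>: increment 0
    is \<open>X S - X 0\<close>, and grid point \<open>j\<close> has index
    \<open>Suc j\<close>.\<close>
  define t where "t k = (case k of 0 \<Rightarrow> 0 | Suc k \<Rightarrow> S + (S + K - S) * (real k / 2 ^ n))" for k
  define Y where "Y k \<omega> = X (t (Suc k)) \<omega> - X (t k) \<omega>" for k \<omega>
  have t0: "t 0 = 0" and t1: "t (Suc 0) = S" and tpos: "0 \<le> t k" for k
    using assms by (auto simp: t_def split: nat.split)
  have grid: "dyadic_grid S (S + K) n = (\<lambda>j. t (Suc j)) ` {..2 ^ n}"
    by (simp add: dyadic_grid_def t_def)
  note [measurable] = random_variables[OF tpos] random_variables[OF less_imp_le[OF assms(1)]] random_variables[OF order_refl]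
  have indep: "indep_vars (\<lambda>_. borel) Y {..<Suc (2 ^ n)}"
    unfolding Y_def
  proof (intro indep_increments)
    show "t i < t (Suc i)" for i
      using assms by (cases i) (auto simp: t_def divide_strict_right_mono)
  qed (simp add: t0)
  define P where "P f \<longleftrightarrow> a < (f 0 :: real)" for f :: "nat \<Rightarrow> real"
  define Q where "Q f \<longleftrightarrow> (\<forall>j\<in>{..2 ^ n}. - (2 * x) \<le> (\<Sum>l\<in>{Suc 0..<Suc j}. f l :: real))" for f
  have P: "Measurable.pred (PiM {0} (\<lambda>_. borel)) P"
    unfolding P_def by measurable
  have Q: "Measurable.pred (PiM {Suc 0..<Suc (2 ^ n)} (\<lambda>_. borel)) Q"
    unfolding Q_def
  proof (rule pred_intros_finite)
    fix j :: nat assume "j \<in> {..2 ^ n}"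
    then have [measurable]: "(\<lambda>f. \<Sum>l\<in>{Suc 0..<Suc j}. f l :: real)
        \<in> borel_measurable (PiM {Suc 0..<Suc (2 ^ n)} (\<lambda>_. borel))"
      by (intro borel_measurable_PiM_sum) auto
    show "Measurable.pred (PiM {Suc 0..<Suc (2 ^ n)} (\<lambda>_. borel))
        (\<lambda>f. - (2 * x) \<le> (\<Sum>l\<in>{Suc 0..<Suc j}. f l :: real))"
      by measurable
  qed simp
  have sub: "{Suc 0..<Suc (2 ^ n)} \<subseteq> {..<Suc (2 ^ n)}"
    by auto
  have P': "P (\<lambda>l\<in>{0}. Y l \<omega>) \<longleftrightarrow> a < X S \<omega> - X 0 \<omega>" for \<omega>
    by (simp add: P_def Y_def t0 t1)
  have sum: "(\<Sum>l\<in>{Suc 0..<Suc j}. (\<lambda>l\<in>{Suc 0..<Suc (2 ^ n)}. Y l \<omega>) l) = X (t (Suc j)) \<omega> - X S \<omega>"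
    if "j \<le> 2 ^ n" for j \<omega>
  proof -
    have "(\<Sum>l\<in>{Suc 0..<Suc j}. (\<lambda>l\<in>{Suc 0..<Suc (2 ^ n)}. Y l \<omega>) l) = (\<Sum>l\<in>{Suc 0..<Suc j}. Y l \<omega>)"
      using that by (intro sum.cong) auto
    also have "\<dots> = X (t (Suc j)) \<omega> - X (t (Suc 0)) \<omega>"
      unfolding Y_def by (rule sum_Suc_diff') simp
    finally show ?thesis by (simp add: t1)
  qed
  have Q': "Q (\<lambda>l\<in>{Suc 0..<Suc (2 ^ n)}. Y l \<omega>) \<longleftrightarrow>
      (\<forall>t\<in>dyadic_grid S (S + K) n. - (2 * x) \<le> X t \<omega> - X S \<omega>)" for \<omega>
    unfolding Q_def grid by (auto simp: sum simp del: restrict_apply sum.op_ivl_Suc)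
  have [measurable]: "random_variable borel (X t)" if "t \<in> dyadic_grid S (S + K) n" for t
    using that tpos by (auto simp: grid)
  have X0: "prob {\<omega> \<in> space M. a < X S \<omega>} = prob {\<omega> \<in> space M. a < X S \<omega> - X 0 \<omega>}"
    using start assms by (intro prob_eq_AE) (auto elim!: eventually_mono)
  have "prob {\<omega> \<in> space M. a < X S \<omega>} *
        prob {\<omega> \<in> space M. \<forall>t\<in>dyadic_points S (S + K). \<bar>X t \<omega>\<bar> \<le> x}
      \<le> prob {\<omega> \<in> space M. a < X S \<omega>} *
        prob {\<omega> \<in> space M. \<forall>t\<in>dyadic_grid S (S + K) n. - (2 * x) \<le> X t \<omega> - X S \<omega>}"
  proof (intro mult_left_mono finite_measure_mono)
    show "{\<omega> \<in> space M. \<forall>t\<in>dyadic_points S (S + K). \<bar>X t \<omega>\<bar> \<le> x}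
      \<subseteq> {\<omega> \<in> space M. \<forall>t\<in>dyadic_grid S (S + K) n. - (2 * x) \<le> X t \<omega> - X S \<omega>}"
    proof safe
      fix \<omega> r assume *: "\<forall>t\<in>dyadic_points S (S + K). \<bar>X t \<omega>\<bar> \<le> x" and "r \<in> dyadic_grid S (S + K) n"
      then have "r \<in> dyadic_points S (S + K)" by (auto simp: dyadic_points_def)
      then have "\<bar>X r \<omega>\<bar> \<le> x" "\<bar>X S \<omega>\<bar> \<le> x"
        using * left_in_dyadic_points by blast+
      then show "- (2 * x) \<le> X r \<omega> - X S \<omega>" by linarith
    qed
    show "{\<omega> \<in> space M. \<forall>t\<in>dyadic_grid S (S + K) n. - (2 * x) \<le> X t \<omega> - X S \<omega>} \<in> events"
      using assms by measurable
  qed simp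
  also have "\<dots> = prob {\<omega> \<in> space M. a < X S \<omega> - X 0 \<omega>} *
      prob {\<omega> \<in> space M. \<forall>t\<in>dyadic_grid S (S + K) n. - (2 * x) \<le> X t \<omega> - X S \<omega>}"
    by (simp only: X0)
  also have "\<dots> = prob {\<omega> \<in> space M. a < X S \<omega> - X 0 \<omega> \<and>
        (\<forall>t\<in>dyadic_grid S (S + K) n. - (2 * x) \<le> X t \<omega> - X S \<omega>)}"
    using indep_vars_prob_conj[OF indep _ _ sub P Q] unfolding P' Q' by simp
  also have "\<dots> = prob {\<omega> \<in> space M. a < X S \<omega> \<and>
        (\<forall>t\<in>dyadic_grid S (S + K) n. - (2 * x) \<le> X t \<omega> - X S \<omega>)}"
    using start assms by (intro prob_eq_AE) (auto elim!: eventually_mono)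
  finally show ?thesis .
qed

text \<open>Here refining the grid shrinks the event, so the limit is taken by continuity from
  above.\<close>

lemma prob_stays_ge:
  assumes "0 < S" "0 < K"
  shows "prob {\<omega> \<in> space M. a < X S \<omega>} *
      prob {\<omega> \<in> space M. \<forall>t\<in>dyadic_points S (S + K). \<bar>X t \<omega>\<bar> \<le> x}
    \<le> prob {\<omega> \<in> space M. a < X S \<omega> \<and> (\<forall>t\<in>dyadic_points S (S + K). - (2 * x) \<le> X t \<omega> - X S \<omega>)}"
proof -
  define B where "B n = {\<omega> \<in> space M. a < X S \<omega> \<and>
    (\<forall>t\<in>dyadic_grid S (S + K) n. - (2 * x) \<le> X t \<omega> - X S \<omega>)}" for n
  have [measurable]: "random_variable borel (X t)" if "t \<in> dyadic_grid S (S + K) n" for t n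
    using that assms dyadic_grid_subset[of S "S + K" n] by (intro random_variables) auto
  have [measurable]: "random_variable borel (X S)"
    using assms by (intro random_variables) auto
  have "B n \<in> sets M" for n
    unfolding B_def by measurable
  moreover have "decseq B"
    unfolding decseq_def B_def using dyadic_grid_mono by blast
  ultimately have "(\<lambda>n. prob (B n)) \<longlonglongrightarrow> prob (\<Inter>n. B n)"
    by (intro finite_Lim_measure_decseq) auto
  also have "(\<Inter>n. B n) = {\<omega> \<in> space M. a < X S \<omega> \<and>
      (\<forall>t\<in>dyadic_points S (S + K). - (2 * x) \<le> X t \<omega> - X S \<omega>)}"
    by (auto simp: B_def dyadic_points_def)
  finally show ?thesis
    using prob_stays_grid_ge[OF assms] unfolding B_def
    by (intro LIMSEQ_le_const) auto
qed

section \<open>Bounds for the ruin probability\<close>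

text \<open>On cadlag paths ruin is a countable combination of events, so the ruin set differs from
  a measurable set only by a null set, and the completion assigns both the same measure.\<close>

lemma parisian_ruin_prob_eq:
  assumes "0 \<le> S" "0 \<le> T"
  shows "parisian_ruin_prob M X c S u T = prob {\<omega> \<in> space M. \<exists>t\<in>dyadic_points 0 S. \<exists>k::nat.
    \<forall>s\<in>dyadic_points t (t + T). u + c * s - X s \<omega> \<le> - inverse (real (Suc k))}" (is "_ = prob ?E")
    and "{\<omega> \<in> space M. \<exists>t\<in>dyadic_points 0 S. \<exists>k::nat.
    \<forall>s\<in>dyadic_points t (t + T). u + c * s - X s \<omega> \<le> - inverse (real (Suc k))} \<in> events"
proof -
  define R where "R = {\<omega> \<in> space M.
    (INF t\<in>{0..S}. SUP s\<in>{t..t + T}. ereal (risk_process c X u s \<omega>)) < 0}"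
  have [measurable]: "random_variable borel (X s)"
    if "t \<in> dyadic_points 0 S" "s \<in> dyadic_points t (t + T)" for t s
    using that dyadic_points_subset[of 0 S] dyadic_points_subset[of t "t + T"] assms
    by (intro random_variables) force
  show E: "?E \<in> events"
    by measurable
  have "AE \<omega> in M. \<omega> \<in> ?E \<longleftrightarrow> \<omega> \<in> R"
    using cadlag_paths AE_space
  proof eventually_elim
    case (elim \<omega>)
    have "((\<lambda>s. u + c * s - X s \<omega>) \<longlongrightarrow> u + c * t - X t \<omega>) (at_right t)" if "0 \<le> t" for t
      by (intro tendsto_intros cadlag_right[OF elim(1) that])
    from parisian_ruin_dyadic_points[OF this assms] elim(2) show ?case
      by (simp add: R_def risk_process_def)
  qed
  then have ae: "AE \<omega> in completion M. \<omega> \<in> ?E \<longleftrightarrow> \<omega> \<in> R"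
    by (rule AE_completion)
  \<comment> \<open>Agreement almost everywhere with a measurable set suffices for membership in the
    completed sigma-algebra.\<close>
  then have "R \<in> sets (completion M)"
    by (rule completion.in_sets_AE[OF _ sets_completionI_sets[OF E]]) (auto simp: R_def)
  then have "measure (completion M) ?E = measure (completion M) R"
    using E by (intro measure_eq_AE[OF ae]) auto
  then show "parisian_ruin_prob M X c S u T = prob ?E"
    using E by (simp add: parisian_ruin_prob_def R_def)
qed

text \<open>At the left end \<open>t\<close> of a ruin window the risk process is negative, and
  since \<open>c * t\<close> is nonnegative, \<open>X t\<close> exceeds \<open>u\<close>.\<close>

lemma parisian_ruin_prob_le:
  assumes "0 \<le> c" "0 < S" "0 \<le> T"
  shows "prob {\<omega> \<in> space M. \<forall>t\<in>dyadic_points 0 S. \<bar>X t \<omega>\<bar> \<le> x} * parisian_ruin_prob M X c S u T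
    \<le> tail_prob M (X S) (u - 2 * x)"
proof -
  have "parisian_ruin_prob M X c S u T \<le> prob {\<omega> \<in> space M. \<exists>t\<in>dyadic_points 0 S. u < X t \<omega>}"
  proof (subst parisian_ruin_prob_eq, goal_cases)
    case 3
    show ?case
    proof (rule finite_measure_mono, safe)
      fix \<omega> t k
      assume t: "t \<in> dyadic_points 0 S"
        and le: "\<forall>s\<in>dyadic_points t (t + T). u + c * s - X s \<omega> \<le> - inverse (real (Suc k))"
      have "u + c * t - X t \<omega> \<le> - inverse (real (Suc k))"
        using le left_in_dyadic_points by blast
      also have "\<dots> < 0" by simp
      finally have "u + c * t < X t \<omega>" by simp
      moreover have "0 \<le> c * t"
        using t dyadic_points_subset[of 0 S] assms by (intro mult_nonneg_nonneg) auto
      ultimately show "\<exists>t\<in>dyadic_points 0 S. u < X t \<omega>"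
        using t by (intro bexI[of _ t]) auto
    next
      have "random_variable borel (X t)" if "t \<in> dyadic_points 0 S" for t
        using that assms by (intro dyadic_points_random_variable[of 0 S]) auto
      note this[measurable]
      show "{\<omega> \<in> space M. \<exists>t\<in>dyadic_points 0 S. u < X t \<omega>} \<in> events"
        by measurable
    qed
  qed (use assms in auto)
  then show ?thesis
    using prob_exceeds_le[OF assms(2), of x u] unfolding tail_prob_def
    by (meson measure_nonneg mult_left_mono order_trans)
qed

text \<open>The window starting at \<open>S\<close> witnesses ruin. In the shift,
  \<open>2 * x\<close> pays for the fall of \<open>X\<close> after \<open>S\<close>,
  \<open>c * (S + K)\<close> for the premiums, and 1 for the strict margin, which is met with
  \<open>k = 0\<close>.\<close>

lemma parisian_ruin_prob_ge:
  assumes "0 \<le> c" "0 < S" "0 \<le> T" "T \<le> K" "0 < K"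
  shows "tail_prob M (X S) (u + (2 * x + c * (S + K) + 1)) *
      prob {\<omega> \<in> space M. \<forall>t\<in>dyadic_points S (S + K). \<bar>X t \<omega>\<bar> \<le> x}
    \<le> parisian_ruin_prob M X c S u T"
proof -
  define a where "a = u + (2 * x + c * (S + K) + 1)"
  have "tail_prob M (X S) a * prob {\<omega> \<in> space M. \<forall>t\<in>dyadic_points S (S + K). \<bar>X t \<omega>\<bar> \<le> x}
    \<le> prob {\<omega> \<in> space M. a < X S \<omega> \<and> (\<forall>t\<in>dyadic_points S (S + K). - (2 * x) \<le> X t \<omega> - X S \<omega>)}"
    unfolding tail_prob_def using prob_stays_ge[OF assms(2,5)] .
  also have "\<dots> \<le> prob {\<omega> \<in> space M. \<exists>t\<in>dyadic_points 0 S. \<exists>k::nat.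
    \<forall>s\<in>dyadic_points t (t + T). u + c * s - X s \<omega> \<le> - inverse (real (Suc k))}"
  proof (rule finite_measure_mono_AE)
    show "AE \<omega> in M.
      \<omega> \<in> {\<omega> \<in> space M. a < X S \<omega> \<and> (\<forall>t\<in>dyadic_points S (S + K). - (2 * x) \<le> X t \<omega> - X S \<omega>)} \<longrightarrow>
      \<omega> \<in> {\<omega> \<in> space M. \<exists>t\<in>dyadic_points 0 S. \<exists>k::nat.
        \<forall>s\<in>dyadic_points t (t + T). u + c * s - X s \<omega> \<le> - inverse (real (Suc k))}"
      using cadlag_paths
    proof (eventually_elim, safe)
      fix \<omega> assume cad: "cadlag (\<lambda>t. X t \<omega>)" and less: "a < X S \<omega>"
        and ge: "\<forall>t\<in>dyadic_points S (S + K). - (2 * x) \<le> X t \<omega> - X S \<omega>"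
      have "u + c * s - X s \<omega> \<le> - inverse (real (Suc 0))" if "s \<in> dyadic_points S (S + T)" for s
      proof -
        have s: "S \<le> s" "s \<le> S + K"
          using that dyadic_points_subset[of S "S + T"] assms by auto
        \<comment> \<open>A dyadic point of \<open>[S, S + T]\<close> need not be one of
          \<open>[S, S + K]\<close>; right continuity supplies the bound there.\<close>
        have "- (2 * x) \<le> X s \<omega> - X S \<omega>"
        proof (rule right_continuous_ge_dyadic_points[where f = "\<lambda>s. X s \<omega> - X S \<omega>", OF _ _ s])
          show "((\<lambda>s. X s \<omega> - X S \<omega>) \<longlongrightarrow> X r \<omega> - X S \<omega>) (at_right r)" if "S \<le> r" for r
            using that assms by (intro tendsto_intros cadlag_right[OF cad]) auto
        qed (use ge in auto)
        moreover have "c * s \<le> c * (S + K)"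
          using s assms by (intro mult_left_mono) auto
        ultimately show ?thesis using less by (simp add: a_def)
      qed
      then show "\<exists>t\<in>dyadic_points 0 S. \<exists>k::nat.
        \<forall>s\<in>dyadic_points t (t + T). u + c * s - X s \<omega> \<le> - inverse (real (Suc k))"
        by (intro bexI[OF _ right_in_dyadic_points] exI[of _ 0] ballI)
    qed
    show "{\<omega> \<in> space M. \<exists>t\<in>dyadic_points 0 S. \<exists>k::nat.
        \<forall>s\<in>dyadic_points t (t + T). u + c * s - X s \<omega> \<le> - inverse (real (Suc k))} \<in> events"
      using assms by (intro parisian_ruin_prob_eq(2)) auto
  qed
  also have "\<dots> = parisian_ruin_prob M X c S u T"
    using assms by (intro parisian_ruin_prob_eq(1)[symmetric]) auto
  finally show ?thesis by (simp add: a_def)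
qed

end

section \<open>Squeezing the ratio\<close>

theorem proposition1p1:
  fixes M :: "'a measure"
    and X :: "real \<Rightarrow> 'a \<Rightarrow> real"
    and c S :: real
    and T :: "real \<Rightarrow> real"
  assumes "c > 0" and "S > 0"
    and "\<And>u. u \<ge> 0 \<Longrightarrow> T u > 0"
    and "bounded (T ` {0..})"
    and "T \<in> borel_measurable (lebesgue_on {0..})"
    and "levy_process M X"
    and "long_tailed M (X S)"
  shows "((\<lambda>u. parisian_ruin_prob M X c S u (T u) / tail_prob M (X S) u) \<longlongrightarrow> 1) at_top"
proof -
  interpret levy_process M X by fact
  have XS: "random_variable borel (X S)"
    using \<open>S > 0\<close> by (intro random_variables) auto
  \<comment> \<open>A single \<open>K\<close> for all windows keeps \<open>q\<close> below
    independent of \<open>u\<close>.\<close>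
  obtain K where K: "0 < K" "\<And>u. 0 \<le> u \<Longrightarrow> T u \<le> K"
    using assms(4) unfolding bounded_pos by force
  define F where "F = tail_prob M (X S)"
  define Z where "Z u = parisian_ruin_prob M X c S u (T u)" for u
  define p where "p k = prob {\<omega> \<in> space M. \<forall>t\<in>dyadic_points 0 S. \<bar>X t \<omega>\<bar> \<le> real k}" for k
  define q where "q k = prob {\<omega> \<in> space M. \<forall>t\<in>dyadic_points S (S + K). \<bar>X t \<omega>\<bar> \<le> real k}" for k
  have p: "p \<longlonglongrightarrow> 1"
    unfolding p_def using assms by (intro prob_dyadic_bounded_tendsto) auto
  have q: "q \<longlonglongrightarrow> 1"
    unfolding q_def using assms K(1) by (intro prob_dyadic_bounded_tendsto) auto
  have shift: "((\<lambda>u. F (u + y) / F u) \<longlongrightarrow> 1) at_top" for y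
    unfolding F_def using XS assms(7) by (rule long_tailed_shift)
  have pos: "eventually (\<lambda>u. 0 < F u) at_top"
    unfolding F_def using assms(7) by (rule long_tailed_tail_pos)
  have upper: "p k * Z u \<le> F (u + - (2 * real k))" if "0 \<le> u" for k u
    using parisian_ruin_prob_le[of c S "T u" "real k" u] assms(1,2) assms(3)[OF that]
    by (simp add: p_def Z_def F_def)
  have lower: "F (u + (2 * real k + c * (S + K) + 1)) * q k \<le> Z u" if "0 \<le> u" for k u
    using parisian_ruin_prob_ge[of c S "T u" K u "real k"] assms(1,2) assms(3)[OF that] K(1) K(2)[OF that]
    by (simp add: q_def Z_def F_def)
  have "((\<lambda>u. Z u / F u) \<longlongrightarrow> 1) at_top"
  proof (rule order_tendstoI)
    fix l :: real assume "l < 1"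
    with q have "eventually (\<lambda>k. l < q k) sequentially"
      by (rule order_tendstoD)
    \<comment> \<open>The level \<open>k\<close> is fixed before \<open>u\<close> grows, so the
      shift stays constant and the long tail absorbs it.\<close>
    then obtain k where k: "l < q k"
      by (auto simp: eventually_sequentially)
    have "((\<lambda>u. F (u + (2 * real k + c * (S + K) + 1)) / F u * q k) \<longlongrightarrow> 1 * q k) at_top"
      by (intro tendsto_intros shift)
    then have "eventually (\<lambda>u. l < F (u + (2 * real k + c * (S + K) + 1)) / F u * q k) at_top"
      using k by (intro order_tendstoD(1)) auto
    with pos eventually_ge_at_top[of 0] show "eventually (\<lambda>u. l < Z u / F u) at_top"
    proof eventually_elim
      case (elim u)
      have "F (u + (2 * real k + c * (S + K) + 1)) * q k / F u \<le> Z u / F u"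
        using lower[OF elim(2), of k] elim(1) by (intro divide_right_mono) auto
      with elim(3) show ?case by simp
    qed
  next
    fix r :: real assume "1 < r"
    then have "1 < r * 1" by simp
    have "(\<lambda>k. r * p k) \<longlonglongrightarrow> r * 1"
      by (intro tendsto_intros p)
    then have "eventually (\<lambda>k. 1 < r * p k) sequentially"
      using \<open>1 < r * 1\<close> by (rule order_tendstoD)
    then obtain k where k: "1 < r * p k"
      by (auto simp: eventually_sequentially)
    \<comment> \<open>Otherwise \<open>r * p k\<close> would be 0; positivity permits cancelling
      \<open>p k\<close> at the end.\<close>
    with \<open>1 < r\<close> have "0 < p k"
      by (auto simp: p_def zero_less_measure_iff)
    have "eventually (\<lambda>u. F (u + - (2 * real k)) / F u < r * p k) at_top"
      using shift k by (rule order_tendstoD)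
    with pos eventually_ge_at_top[of 0] show "eventually (\<lambda>u. Z u / F u < r) at_top"
    proof eventually_elim
      case (elim u)
      have "p k * Z u / F u \<le> F (u + - (2 * real k)) / F u"
        using upper[OF elim(2), of k] elim(1) by (intro divide_right_mono) auto
      with elim(3) have "p k * (Z u / F u) < p k * r"
        by (simp add: mult.commute)
      then show ?case using \<open>0 < p k\<close> by (simp only: mult_less_cancel_left_pos)
    qed
  qed
  then show ?thesis by (simp add: Z_def F_def)
qed

end
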